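(* Let $X$ be a real Banach space and let $A:X\rightrightarrows X^*$ be ultramaximally monotone. Then $$\operatorname{int}\operatorname{ran} A=\operatorname{int}\left[\operatorname{conv}\operatorname{ran} A\right]=\operatorname{int}\left[P_{X^*}\operatorname{dom} F_A\right]=\operatorname{int}\left[P_{X^*}\operatorname{dom}\Phi_A\right]$$ and $$\overline{\operatorname{ran} A}=\overline{\operatorname{conv}\operatorname{ran} A}=\overline{P_{X^*}\operatorname{dom} F_A}=\overline{P_{X^*}\operatorname{dom}\Phi_A}.$$
   Context: $X$ is a real Banach space with dual $X^*$ and bidual $X^{**}$; $X$ is identified with its canonical image in $X^{**}$, and $\langle\cdot,\cdot\rangle$ denotes the duality pairing. For a set-valued operator $A:X\rightrightarrows X^*$, $\operatorname{gra}A=\{(x,x^* )\in X\times X^*\mid x^*\in Ax\}$ and $\operatorname{ran}A=\bigcup_{x\in X}Ax$. $A$ is monotone if $\langle x-y,x^*-y^*\rangle\ge 0$ for all $(x,x^* ),(y,y^* )\in\operatorname{gra}A$. A monotone $A$ is ultramaximally monotone if it is maximally monotone with respect to $X^{**}\times X^*$: whenever $(x^{**},x^* )\in X^{**}\times X^*$ satisfies $\langle x^{**}-a,x^*-a^*\rangle\ge 0$ for all $(a,a^* )\in\operatorname{gra}A$, then $x^{**}\in X$ and $(x^{**},x^* )\in\operatorname{gra}A$. The Fitzpatrick function $F_A:X\times X^*\to\,]-\infty,+\infty]$ is $F_A(x,x^* )=\sup_{(a,a^* )\in\operatorname{gra}A}\big(\langle x,a^*\rangle+\langle a,x^*\rangle-\langle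 a,a^*\rangle\big)$, and $\Phi_A$ on $X^{**}\times X^*$ is $\Phi_A(x^{**},x^* )=\sup_{(a,a^* )\in\operatorname{gra}A}\big(\langle x^{**},a^*\rangle+\langle a,x^*\rangle-\langle a,a^*\rangle\big)$. The domain of an extended-real-valued function is the set of points where it is finite. $P_{X^*}$ is the projection $(x,x^* )\mapsto x^*$ (on $X\times X^*$, respectively on $X^{**}\times X^*$). $\operatorname{int}$ and the overline denote interior and closure in the norm topology of $X^*$, and $\operatorname{conv}$ denotes convex hull. *)

theory Defs
  imports "HOL-Analysis.Analysis"
begin

type_synonym 'a dual = "'a \<Rightarrow>\<^sub>L real"
type_synonym 'a bidual = "('a \<Rightarrow>\<^sub>L real) \<Rightarrow>\<^sub>L real"

lift_definition bidual_embed :: "'a::real_normed_vector \<Rightarrow> 'a bidual"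
  is "\<lambda>x x'. blinfun_apply x' x"
  by (rule blinfun.bounded_linear_left)

lemma bidual_embed_apply [simp]: "blinfun_apply (bidual_embed x) x' = blinfun_apply x' x"
  by transfer simp

definition gra :: "('a::real_normed_vector \<Rightarrow> 'a dual set) \<Rightarrow> ('a \<times> 'a dual) set" where
  "gra A = {(x, x'). x' \<in> A x}"

definition op_ran :: "('a::real_normed_vector \<Rightarrow> 'a dual set) \<Rightarrow> 'a dual set" where
  "op_ran A = (\<Union>x. A x)"

definition monotone_op :: "('a::real_normed_vector \<Rightarrow> 'a dual set) \<Rightarrow> bool" where
  "monotone_op A \<longleftrightarrow>
     (\<forall>(x, x') \<in> gra A. \<forall>(y, y') \<in> gra A. blinfun_apply (x' - y') (x - y) \<ge> 0)"

text \<open>A bidual point belongs to the space when it lies in the range of the canonical embedding.\<close>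

definition ultramaximally_monotone :: "('a::real_normed_vector \<Rightarrow> 'a dual set) \<Rightarrow> bool" where
  "ultramaximally_monotone A \<longleftrightarrow>
     monotone_op A \<and>
     (\<forall>x'' x'. (\<forall>(a, a') \<in> gra A. blinfun_apply (x'' - bidual_embed a) (x' - a') \<ge> 0) \<longrightarrow>
        (\<exists>x. x'' = bidual_embed x \<and> (x, x') \<in> gra A))"

text \<open>The suprema are taken in the extended reals, so the empty graph gives \<open>-\<infinity>\<close>; the graph
  of an ultramaximally monotone operator is never empty.\<close>

definition Fitzpatrick :: "('a::real_normed_vector \<Rightarrow> 'a dual set) \<Rightarrow> 'a \<times> 'a dual \<Rightarrow> ereal" where
  "Fitzpatrick A = (\<lambda>(x, x').
     SUP (a, a') \<in> gra A. ereal (blinfun_apply a' x + blinfun_apply x' a - blinfun_apply a' a))"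

definition Fitzpatrick_bidual ::
    "('a::real_normed_vector \<Rightarrow> 'a dual set) \<Rightarrow> 'a bidual \<times> 'a dual \<Rightarrow> ereal" where
  "Fitzpatrick_bidual A = (\<lambda>(x'', x').
     SUP (a, a') \<in> gra A. ereal (blinfun_apply x'' a' + blinfun_apply x' a - blinfun_apply a' a))"

definition finite_dom :: "('b \<Rightarrow> ereal) \<Rightarrow> 'b set" where
  "finite_dom f = {z. \<bar>f z\<bar> \<noteq> \<infinity>}"

end

theory Submission
  imports Defs
begin

text \<open>
  Since \<open>ran A \<subseteq> conv ran A \<subseteq> P dom F\<^sub>A \<subseteq> P dom \<Phi>\<^sub>A\<close> with \<open>P = P\<^sub>X\<^sub>*\<close>, it suffices that every point of \<open>P dom \<Phi>\<^sub>A\<close> lies in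
  the closure of \<open>ran A\<close>, and every interior point in \<open>ran A\<close>; translating \<open>A\<close>, the point is \<open>0\<close>.
  Let \<open>H\<close> be the convex hull of the points \<open>((a', a), \<langle>a, a'\<rangle>)\<close> for \<open>(a, a')\<close> in the graph;
  monotonicity gives \<open>t \<ge> \<langle>w, w'\<rangle>\<close> for all \<open>((w', w), t) \<in> H\<close>. If \<open>g\<close> is convex and continuous
  and \<open>t + g (w', w) \<ge> 0\<close> on \<open>H\<close>, the Hahn-Banach theorem on \<open>X* \<times> X\<close> produces a pair
  \<open>(z'', z')\<close> to which ultramaximality can be applied.

  For the closure, take \<open>g (v', v) = \<parallel>v'\<parallel>\<^sup>2 / (2 m) + m \<parallel>v\<parallel>\<^sup>2 / 2\<close>: this yields \<open>(z, z')\<close> in the graph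
  with \<open>\<langle>z, z'\<rangle> \<le> - \<parallel>z'\<parallel>\<^sup>2 / (2 m)\<close>, and \<open>\<langle>z, z'\<rangle>\<close> is bounded below by an affine function of \<open>\<parallel>z'\<parallel>\<close>
  because \<open>0 \<in> P dom \<Phi>\<^sub>A\<close>; so \<open>z' \<rightarrow> 0\<close> as \<open>m \<rightarrow> 0\<close>. For the interior, the uniform boundedness
  principle bounds \<open>\<parallel>w\<parallel>\<close> by \<open>k (t + n (1 + \<parallel>w'\<parallel>))\<close> on \<open>H\<close>, whence \<open>t + K \<parallel>w'\<parallel> \<ge> 0\<close> for large \<open>K\<close>;
  then \<open>g (v', v) = K \<parallel>v'\<parallel>\<close> gives \<open>z''\<close> such that \<open>(z'', 0)\<close> is monotonically related to the graph.
\<close>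

subsection \<open>The Hahn-Banach theorem\<close>

definition sublinear :: "('a::real_vector \<Rightarrow> real) \<Rightarrow> bool" where
  "sublinear p \<longleftrightarrow> (\<forall>x y. p (x + y) \<le> p x + p y) \<and> (\<forall>c>0. \<forall>x. p (c *\<^sub>R x) = c * p x)"

lemma sublinear_add: "sublinear p \<Longrightarrow> p (x + y) \<le> p x + p y"
  and sublinear_scaleR: "sublinear p \<Longrightarrow> c > 0 \<Longrightarrow> p (c *\<^sub>R x) = c * p x"
  by (auto simp: sublinear_def)

lemma sublinear_zero: "sublinear p \<Longrightarrow> p 0 = 0"
  using sublinear_scaleR[of p 2 0] by simp

lemma sublinear_minus: "sublinear p \<Longrightarrow> - p (- x) \<le> p x"
  using sublinear_add[of p x "- x"] by (simp add: sublinear_zero)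

text \<open>Subadditivity is where the chain matters: of two members \<open>q\<close> and
  \<open>r\<close> the smaller one, \<open>s\<close>, satisfies
  \<open>s (x + y) \<le> s x + s y \<le> q x + r y\<close>. For homogeneity one inequality suffices,
  since the other follows by using it for \<open>inverse c\<close>.\<close>

lemma sublinear_chain_Inf:
  assumes C: "C \<noteq> {}" "\<And>q. q \<in> C \<Longrightarrow> sublinear q"
    and chain: "\<And>q r. q \<in> C \<Longrightarrow> r \<in> C \<Longrightarrow> q \<le> r \<or> r \<le> q"
    and bdd: "\<And>x. bdd_below ((\<lambda>q. q x) ` C)"
  shows "sublinear (\<lambda>x. INF q\<in>C. q x)"
  unfolding sublinear_def
proof (intro conjI allI impI)
  fix x y
  show "(INF q\<in>C. q (x + y)) \<le> (INF q\<in>C. q x) + (INF q\<in>C. q y)"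
  proof -
    have *: "(INF q\<in>C. q (x + y)) \<le> q x + r y" if qr: "q \<in> C" "r \<in> C" for q r
    proof -
      obtain s where s: "s \<in> C" "s \<le> q" "s \<le> r"
        using chain[OF qr] qr by blast
      have "(INF q\<in>C. q (x + y)) \<le> s (x + y)"
        by (rule cINF_lower[OF bdd s(1)])
      also have "\<dots> \<le> s x + s y"
        by (rule sublinear_add[OF C(2)[OF s(1)]])
      also have "\<dots> \<le> q x + r y"
        using s(2,3) by (auto simp: le_fun_def intro: add_mono)
      finally show ?thesis .
    qed
    have "(INF q\<in>C. q (x + y)) - r y \<le> (INF q\<in>C. q x)" if "r \<in> C" for r
      using *[OF _ that] by (intro cINF_greatest C) (simp add: algebra_simps)
    then have "(INF q\<in>C. q (x + y)) - (INF q\<in>C. q x) \<le> (INF q\<in>C. q y)"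
      by (intro cINF_greatest C) (simp add: algebra_simps)
    then show ?thesis by simp
  qed
next
  have le: "c * (INF q\<in>C. q x) \<le> (INF q\<in>C. q (c *\<^sub>R x))" if "c > 0" for c :: real and x
    using that by (intro cINF_greatest C) (simp add: sublinear_scaleR C cINF_lower[OF bdd])
  fix c :: real and x assume "c > 0"
  have "inverse c * (INF q\<in>C. q (c *\<^sub>R x)) \<le> (INF q\<in>C. q x)"
    using le[of "inverse c" "c *\<^sub>R x"] \<open>c > 0\<close> by simp
  with \<open>c > 0\<close> have "(INF q\<in>C. q (c *\<^sub>R x)) \<le> c * (INF q\<in>C. q x)"
    by (simp add: field_simps)
  with le[OF \<open>c > 0\<close>] show "(INF q\<in>C. q (c *\<^sub>R x)) = c * (INF q\<in>C. q x)"
    by (intro antisym)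
qed

text \<open>For fixed \<open>y\<close>, the largest possible decrease of \<open>q\<close> along the
  ray of \<open>y\<close> gives a sublinear \<open>r\<close> below \<open>q\<close>. Minimality
  forces \<open>r = q\<close>, and the parameter \<open>l = 1\<close> then reads
  \<open>q x + q y \<le> q (x + y)\<close>.\<close>

lemma minimal_sublinear_imp_linear:
  assumes q: "sublinear q" and min: "\<And>r. sublinear r \<Longrightarrow> r \<le> q \<Longrightarrow> r = q"
  shows "linear q"
proof -
  have add: "q (x + y) = q x + q y" for x y
  proof -
    define r where "r = (\<lambda>x. INF l\<in>{0..}. q (x + l *\<^sub>R y) - l * q y)"
    \<comment> \<open>A lower bound independent of \<open>l\<close> makes the infimum defining
      \<open>r\<close> finite.\<close>
    have low: "- q (- x) \<le> q (x + l *\<^sub>R y) - l * q y" if "l \<ge> 0" for x l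
    proof -
      have "l * q y = q (l *\<^sub>R y)"
        using that q by (cases "l = 0") (auto simp: sublinear_scaleR sublinear_zero)
      then show ?thesis
        using sublinear_add[OF q, of "x + l *\<^sub>R y" "- x"] by simp
    qed
    have bdd: "bdd_below ((\<lambda>l. q (x + l *\<^sub>R y) - l * q y) ` {0..})" for x
      using low by (intro bdd_belowI2[of _ "- q (- x)"]) auto
    have r_le: "r x \<le> q (x + l *\<^sub>R y) - l * q y" if "l \<ge> 0" for x l
      unfolding r_def using that by (intro cINF_lower[OF bdd]) auto
    have r_ge: "m \<le> r x" if "\<And>l. l \<ge> 0 \<Longrightarrow> m \<le> q (x + l *\<^sub>R y) - l * q y" for m x
      unfolding r_def using that by (intro cINF_greatest) auto
    have "sublinear r"
      unfolding sublinear_def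
    proof (intro conjI allI impI)
      fix u v
      have "r (u + v) \<le> (q (u + l *\<^sub>R y) - l * q y) + (q (v + k *\<^sub>R y) - k * q y)"
        if "l \<ge> 0" "k \<ge> 0" for l k
        using r_le[of "l + k" "u + v"] that sublinear_add[OF q, of "u + l *\<^sub>R y" "v + k *\<^sub>R y"]
        by (simp add: algebra_simps)
      then have "r (u + v) - (q (v + k *\<^sub>R y) - k * q y) \<le> r u" if "k \<ge> 0" for k
        using that by (intro r_ge) (simp add: algebra_simps)
      then have "r (u + v) - r u \<le> r v"
        by (intro r_ge) (simp add: algebra_simps)
      then show "r (u + v) \<le> r u + r v" by simp
    next
      have le: "c * r u \<le> r (c *\<^sub>R u)" if "c > 0" for c u
      proof (rule r_ge)
        fix l :: real assume "l \<ge> 0"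
        then have "c * r u \<le> c * (q (u + (l / c) *\<^sub>R y) - (l / c) * q y)"
          using that by (intro mult_left_mono r_le) auto
        also have "\<dots> = q (c *\<^sub>R (u + (l / c) *\<^sub>R y)) - l * q y"
          using that q by (simp add: sublinear_scaleR right_diff_distrib)
        finally show "c * r u \<le> q (c *\<^sub>R u + l *\<^sub>R y) - l * q y"
          using that by (simp add: scaleR_right_distrib)
      qed
      fix c :: real and u assume "c > 0"
      have "inverse c * r (c *\<^sub>R u) \<le> r u"
        using le[of "inverse c" "c *\<^sub>R u"] \<open>c > 0\<close> by simp
      with \<open>c > 0\<close> have "r (c *\<^sub>R u) \<le> c * r u"
        by (simp add: field_simps)
      with le[OF \<open>c > 0\<close>] show "r (c *\<^sub>R u) = c * r u"
        by (intro antisym)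
    qed
    moreover have "r \<le> q"
      using r_le[of 0] by (auto simp: le_fun_def)
    ultimately have "r = q" by (rule min)
    then have "q x \<le> q (x + y) - q y"
      using r_le[of 1 x] by simp
    with sublinear_add[OF q, of x y] show ?thesis by simp
  qed
  have minus: "q (- x) = - q x" for x
    using add[of x "- x"] by (simp add: sublinear_zero[OF q])
  show ?thesis
  proof (rule linearI)
    fix c :: real and x
    show "q (c *\<^sub>R x) = c *\<^sub>R q x"
    proof (cases c "0 :: real" rule: linorder_cases)
      case less
      then show ?thesis
        using sublinear_scaleR[OF q, of "- c" x] minus[of "c *\<^sub>R x"] by simp
    qed (auto simp: sublinear_zero[OF q] sublinear_scaleR[OF q])
  qed (rule add)
qed

theorem hahn_banach_sublinear:
  assumes p: "sublinear p"
  shows "\<exists>f. linear f \<and> f \<le> p"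
proof -
  define S where "S = {q. sublinear q \<and> q \<le> p}"
  \<comment> \<open>Zorn's lemma for the reversed order yields a minimal element; the pointwise
    infimum of a chain serves as its bound.\<close>
  have "\<exists>m\<in>S. \<forall>q\<in>S. m \<ge> q \<longrightarrow> q = m"
  proof (rule predicate_Zorn)
    show "partial_order_on S (relation_of (\<ge>) S)"
      by (auto simp: partial_order_on_def preorder_on_def refl_on_def trans_def antisym_def
          relation_of_def)
    fix C assume "C \<in> Chains (relation_of (\<ge>) S)"
    then have C: "C \<subseteq> S" "\<And>q r. q \<in> C \<Longrightarrow> r \<in> C \<Longrightarrow> q \<le> r \<or> r \<le> q"
      by (auto simp: Chains_def relation_of_def)
    show "\<exists>u\<in>S. \<forall>a\<in>C. a \<ge> u"
    proof (cases "C = {}")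
      case True
      then show ?thesis using p by (auto simp: S_def)
    next
      case False
      have low: "- p (- x) \<le> q x" if "q \<in> C" for q x
      proof -
        from that C have "sublinear q" "q (- x) \<le> p (- x)"
          by (auto simp: S_def le_fun_def)
        then show ?thesis using sublinear_minus[of q x] by linarith
      qed
      have bdd: "bdd_below ((\<lambda>q. q x) ` C)" for x
        using low by (intro bdd_belowI2[of _ "- p (- x)"])
      define u where "u = (\<lambda>x. INF q\<in>C. q x)"
      have u_le: "u \<le> q" if "q \<in> C" for q
        unfolding u_def le_fun_def using that by (auto intro: cINF_lower[OF bdd])
      moreover have "sublinear u"
        unfolding u_def using C False bdd by (intro sublinear_chain_Inf) (auto simp: S_def)
      moreover have "u \<le> p"
        using False u_le C by (force simp: S_def intro: order_trans)
      ultimately show ?thesis by (auto simp: S_def)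
    qed
  qed
  then obtain m where m: "m \<in> S" "\<And>q. q \<in> S \<Longrightarrow> q \<le> m \<Longrightarrow> q = m" by blast
  have "linear m"
  proof (rule minimal_sublinear_imp_linear)
    show "sublinear m" using m by (simp add: S_def)
    show "r = m" if "sublinear r" "r \<le> m" for r
      using m that by (auto simp: S_def intro: order_trans)
  qed
  with m show ?thesis by (auto simp: S_def)
qed

text \<open>\<open>f\<close> is found below the sublinear functional \<open>p y = inf {s / l | l > 0, (l y, s) \<in> C}\<close>.\<close>

lemma hahn_banach_convex_set:
  fixes C :: "('a::real_vector \<times> real) set"
  assumes C: "convex C" and total: "\<And>y. \<exists>s. (y, s) \<in> C"
    and zero: "\<And>s. (0, s) \<in> C \<Longrightarrow> 0 \<le> s"
  shows "\<exists>f. linear f \<and> (\<forall>(y, s)\<in>C. f y \<le> s)"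
proof -
  define R where "R y = {s / l | l s. l > 0 \<and> (l *\<^sub>R y, s) \<in> C}" for y
  have comb: "\<exists>z. z \<in> R (x + y) \<and> z = a + b" if ab: "a \<in> R x" "b \<in> R y" for x y a b
  proof -
    obtain l s k t where ls: "l > 0" "(l *\<^sub>R x, s) \<in> C" "a = s / l"
      and kt: "k > 0" "(k *\<^sub>R y, t) \<in> C" "b = t / k"
      using ab unfolding R_def by blast
    have pos: "l + k > 0" using ls kt by simp
    \<comment> \<open>The weights are chosen so that \<open>x\<close> and \<open>y\<close> receive
      the same factor \<open>l * k / (l + k)\<close>, which exhibits \<open>a + b\<close> as a
      quotient in \<open>R (x + y)\<close>.\<close>
    have "(k / (l + k)) *\<^sub>R (l *\<^sub>R x, s) + (l / (l + k)) *\<^sub>R (k *\<^sub>R y, t) \<in> C"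
      using ls kt pos by (intro convexD[OF C]) (auto simp: add_divide_distrib[symmetric] add.commute)
    moreover have "(k / (l + k)) *\<^sub>R (l *\<^sub>R x, s) + (l / (l + k)) *\<^sub>R (k *\<^sub>R y, t) =
        ((l * k / (l + k)) *\<^sub>R (x + y), (k * s + l * t) / (l + k))"
      using pos by (simp add: scaleR_right_distrib mult.commute add_divide_distrib)
    moreover have "a + b = ((k * s + l * t) / (l + k)) / (l * k / (l + k))"
    proof -
      have "k * s + l * t = (a + b) * (l * k)" using ls kt by (simp add: field_simps)
      then show ?thesis using ls kt pos by simp
    qed
    moreover have "l * k / (l + k) > 0" using ls kt by simp
    ultimately show ?thesis
      unfolding R_def by (metis (mono_tags, lifting) mem_Collect_eq)
  qed
  have nonneg: "0 \<le> a" if "a \<in> R 0" for a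
    using that zero by (auto simp: R_def)
  have ne: "R y \<noteq> {}" for y
  proof -
    obtain s where "(y, s) \<in> C" using total by blast
    then have "s / 1 \<in> R y" unfolding R_def by (intro CollectI exI[of _ 1] exI[of _ s]) simp
    then show ?thesis by blast
  qed
  \<comment> \<open>Adding any element of \<open>R (- y)\<close> lands in \<open>R 0\<close>, whose
    elements are nonnegative.\<close>
  have bdd: "bdd_below (R y)" for y
  proof -
    obtain b where "b \<in> R (- y)" using ne by blast
    then have "- b \<le> a" if "a \<in> R y" for a
      using comb[OF that] nonneg by fastforce
    then show ?thesis by (rule bdd_belowI)
  qed
  define p where "p y = Inf (R y)" for y
  have "sublinear p"
    unfolding sublinear_def
  proof (intro conjI allI impI)
    fix x y
    have "p (x + y) \<le> a + b" if "a \<in> R x" "b \<in> R y" for a b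
      unfolding p_def using comb[OF that] by (auto intro: cInf_lower[OF _ bdd])
    then have "p (x + y) - b \<le> p x" if "b \<in> R y" for b
      unfolding p_def[of x] using that ne by (intro cInf_greatest) (auto simp: algebra_simps)
    then have "p (x + y) - p x \<le> p y"
      unfolding p_def[of y] using ne by (intro cInf_greatest) (auto simp: algebra_simps)
    then show "p (x + y) \<le> p x + p y" by simp
  next
    have le: "c * p x \<le> p (c *\<^sub>R x)" if "c > 0" for c x
      unfolding p_def[of "c *\<^sub>R x"]
    proof (rule cInf_greatest[OF ne])
      fix z assume "z \<in> R (c *\<^sub>R x)"
      then obtain l s where "l > 0" "((l * c) *\<^sub>R x, s) \<in> C" "z = s / l"
        by (auto simp: R_def)
      with that have "z / c \<in> R x"
        unfolding R_def by (intro CollectI exI[of _ "l * c"] exI[of _ s]) simp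
      then have "p x \<le> z / c"
        unfolding p_def by (rule cInf_lower[OF _ bdd])
      with that show "c * p x \<le> z" by (simp add: field_simps)
    qed
    fix c :: real and x assume "c > 0"
    have "inverse c * p (c *\<^sub>R x) \<le> p x"
      using le[of "inverse c" "c *\<^sub>R x"] \<open>c > 0\<close> by simp
    with \<open>c > 0\<close> have "p (c *\<^sub>R x) \<le> c * p x"
      by (simp add: field_simps)
    with le[OF \<open>c > 0\<close>] show "p (c *\<^sub>R x) = c * p x"
      by (intro antisym)
  qed
  then obtain f where f: "linear f" "f \<le> p" using hahn_banach_sublinear by blast
  have "f y \<le> s" if "(y, s) \<in> C" for y s
  proof -
    have "s \<in> R y" using that unfolding R_def by (intro CollectI exI[of _ 1] exI[of _ s]) simp
    then have "p y \<le> s" unfolding p_def by (rule cInf_lower[OF _ bdd])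
    with f(2) show ?thesis by (auto simp: le_fun_def intro: order_trans)
  qed
  with f(1) show ?thesis by blast
qed

lemma linear_bounded_above_imp_bounded_linear:
  fixes f :: "'a::real_normed_vector \<Rightarrow> real"
  assumes f: "linear f" and r: "r > 0" and M: "\<And>y. norm y \<le> r \<Longrightarrow> f y \<le> M"
  shows "bounded_linear f"
proof (rule bounded_linear_intro)
  fix x y show "f (x + y) = f x + f y" using f by (rule linear_add)
  fix c show "f (c *\<^sub>R x) = c *\<^sub>R f x" using f by (rule linear_scale)
  have abs: "\<bar>f y\<bar> \<le> M" if "norm y \<le> r" for y
    using M[of y] M[of "- y"] that linear_neg[OF f, of y] by auto
  show "norm (f x) \<le> norm x * (M / r)"
  proof (cases "x = 0")
    case True
    then show ?thesis using linear_0[OF f] by simp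
  next
    case False
    have "\<bar>f ((r / norm x) *\<^sub>R x)\<bar> \<le> M"
      using False r by (intro abs) simp
    with False r show ?thesis
      by (simp add: linear_scale[OF f] abs_mult field_simps)
  qed
qed

text \<open>The nonnegativity hypothesis says that the infimal convolution
  \<open>y \<mapsto> inf {t + g (w - y) | (w, t) \<in> H}\<close> is nonnegative at
  \<open>0\<close>. The functional \<open>f\<close> is a linear minorant of it, and
  \<open>y = w - v\<close> gives the claim. The set \<open>C\<close> is essentially its
  epigraph.\<close>

lemma convex_sandwich:
  fixes H :: "('a::real_normed_vector \<times> real) set" and g :: "'a \<Rightarrow> real"
  assumes H: "convex H" "H \<noteq> {}" and g: "convex_on UNIV g" "continuous_on UNIV g"
    and nonneg: "\<And>w t. (w, t) \<in> H \<Longrightarrow> 0 \<le> t + g w"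
  shows "\<exists>f :: 'a \<Rightarrow>\<^sub>L real. \<forall>(w, t)\<in>H. \<forall>v. f (w - v) \<le> t + g v"
proof -
  define C where "C = {(y, s). \<exists>w t. (w, t) \<in> H \<and> t + g (w - y) \<le> s}"
  have "convex C"
  proof (rule convexI)
    fix p q and u v :: real
    assume "p \<in> C" "q \<in> C" and uv: "0 \<le> u" "0 \<le> v" "u + v = 1"
    then obtain y s w t y' s' w' t' where pq: "p = (y, s)" "q = (y', s')"
      and H': "(w, t) \<in> H" "(w', t') \<in> H"
      and le: "t + g (w - y) \<le> s" "t' + g (w' - y') \<le> s'"
      by (auto simp: C_def)
    have 1: "(u *\<^sub>R w + v *\<^sub>R w', u * t + v * t') \<in> H"
      using convexD[OF H(1) H' uv] by simp
    have "g (u *\<^sub>R (w - y) + v *\<^sub>R (w' - y')) \<le> u * g (w - y) + v * g (w' - y')"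
      using g(1) uv unfolding convex_on_def by auto
    also have "\<dots> \<le> u * (s - t) + v * (s' - t')"
      using le uv by (intro add_mono mult_left_mono) auto
    finally have "u * t + v * t' + g ((u *\<^sub>R w + v *\<^sub>R w') - (u *\<^sub>R y + v *\<^sub>R y')) \<le> u * s + v * s'"
      by (simp add: algebra_simps)
    with 1 show "u *\<^sub>R p + v *\<^sub>R q \<in> C" by (auto simp: C_def pq)
  qed
  moreover obtain w0 t0 where w0: "(w0, t0) \<in> H" using H(2) by auto
  then have C0: "(y, t0 + g (w0 - y)) \<in> C" for y
    by (auto simp: C_def)
  moreover have "0 \<le> s" if "(0, s) \<in> C" for s
    using that nonneg by (fastforce simp: C_def)
  ultimately obtain f where f: "linear f" and fle: "\<And>y s. (y, s) \<in> C \<Longrightarrow> f y \<le> s"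
    using hahn_banach_convex_set[of C] by blast
  \<comment> \<open>Continuity of \<open>g\<close> at a single \<open>w0\<close> bounds
    \<open>f\<close> above near \<open>0\<close>, which is enough for boundedness of
    \<open>f\<close>.\<close>
  have "isCont g w0" using g(2) by (simp add: continuous_on_eq_continuous_at)
  then obtain d where d: "d > 0" "\<And>x. dist x w0 < d \<Longrightarrow> dist (g x) (g w0) < 1"
    unfolding continuous_at_eps_delta by (metis zero_less_one)
  have "bounded_linear f"
  proof (rule linear_bounded_above_imp_bounded_linear[OF f])
    show "d / 2 > 0" using d by simp
    fix y :: 'a assume "norm y \<le> d / 2"
    then have "dist (g (w0 - y)) (g w0) < 1"
      using d by (intro d(2)) (simp add: dist_norm)
    then show "f y \<le> t0 + (g w0 + 1)"
      using fle[OF C0, of y] by (simp add: dist_real_def)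
  qed
  then have "blinfun_apply (Blinfun f) = f" by (rule bounded_linear_Blinfun_apply)
  moreover have "f (w - v) \<le> t + g v" if "(w, t) \<in> H" for w t v
    using that by (intro fle) (auto simp: C_def intro!: exI[of _ w] exI[of _ t])
  ultimately show ?thesis by (intro exI[of _ "Blinfun f"]) auto
qed

subsection \<open>The uniform boundedness principle\<close>

text \<open>The closed sets \<open>D n\<close> cover the space, so by Baire's theorem one of them
  contains a ball; differences of values at \<open>c + v\<close> and at the centre \<open>c\<close>
  carry the bound to a ball around \<open>0\<close>.\<close>

theorem uniform_boundedness:
  fixes F :: "('a::banach \<Rightarrow>\<^sub>L 'b::real_normed_vector) set"
  assumes "\<And>x. \<exists>k. \<forall>f\<in>F. norm (f x) \<le> k"
  shows "\<exists>k\<ge>0. \<forall>f\<in>F. norm f \<le> k"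
proof -
  define D where "D n = {x. \<forall>f\<in>F. norm (blinfun_apply f x) \<le> real n}" for n
  have closed: "closed (D n)" for n
    unfolding D_def by (simp only: Collect_ball_eq) (intro closed_INT ballI closed_Collect_le continuous_intros)
  have "\<exists>n. interior (D n) \<noteq> {}"
  proof (rule ccontr)
    assume "\<not> ?thesis"
    then have "euclidean interior_of \<Union>(range D) = {}"
      using closed by (intro Baire_category_alt) (auto simp: completely_metrizable_space_euclidean)
    moreover have "\<Union>(range D) = UNIV"
    proof -
      have "\<exists>n. x \<in> D n" for x
      proof -
        obtain k where "\<forall>f\<in>F. norm (f x) \<le> k" using assms by blast
        moreover obtain n where "k \<le> real n" using real_arch_simple by blast
        ultimately have "x \<in> D n" by (auto simp: D_def intro: order_trans)
        then show ?thesis ..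
      qed
      then show ?thesis by auto
    qed
    ultimately show False by simp
  qed
  then obtain n c where "c \<in> interior (D n)" by auto
  then obtain r where r: "r > 0" "cball c r \<subseteq> D n" by (auto simp: mem_interior_cball)
  have "norm f \<le> 2 * real n / r" if "f \<in> F" for f
  proof (rule norm_blinfun_bound)
    fix x
    have *: "norm (f v) \<le> 2 * n" if "norm v \<le> r" for v
    proof -
      have "c + v \<in> D n" "c \<in> D n" using r that by (auto simp: dist_norm subset_iff)
      then have "norm (f (c + v)) \<le> n" "norm (f c) \<le> n" using \<open>f \<in> F\<close> by (auto simp: D_def)
      then show ?thesis
        using norm_triangle_ineq4[of "f (c + v)" "f c"] by (simp add: blinfun.add_right)
    qed
    show "norm (f x) \<le> 2 * real n / r * norm x"
    proof (cases "x = 0")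
      case False
      with r *[of "(r / norm x) *\<^sub>R x"] show ?thesis
        by (simp add: blinfun.scaleR_right field_simps)
    qed simp
  qed (use r in simp)
  with r show ?thesis by (intro exI[of _ "2 * real n / r"]) auto
qed

subsection \<open>Squared norms\<close>

lemma convex_on_norm_linear:
  assumes "linear f"
  shows "convex_on UNIV (\<lambda>x. norm (f x))"
proof (rule convex_onI)
  fix t :: real and x y assume "0 < t" "t < 1"
  then show "norm (f ((1 - t) *\<^sub>R x + t *\<^sub>R y)) \<le> (1 - t) * norm (f x) + t * norm (f y)"
    using norm_triangle_ineq[of "(1 - t) *\<^sub>R f x" "t *\<^sub>R f y"]
    by (simp add: linear_add[OF assms] linear_scale[OF assms])
qed simp

lemma convex_on_norm_linear_square:
  assumes "linear f"
  shows "convex_on UNIV (\<lambda>x. (norm (f x))\<^sup>2)"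
proof (rule convex_onI)
  fix t :: real and x y assume t: "0 < t" "t < 1"
  have "(norm (f ((1 - t) *\<^sub>R x + t *\<^sub>R y)))\<^sup>2 \<le> ((1 - t) * norm (f x) + t * norm (f y))\<^sup>2"
    using t by (intro power_mono convex_onD[OF convex_on_norm_linear[OF assms]]) auto
  also have "\<dots> \<le> (1 - t) * (norm (f x))\<^sup>2 + t * (norm (f y))\<^sup>2"
    using t convex_onD[OF convex_power2, of t "norm (f x)" "norm (f y)"] by simp
  finally show "(norm (f ((1 - t) *\<^sub>R x + t *\<^sub>R y)))\<^sup>2 \<le> (1 - t) * (norm (f x))\<^sup>2 + t * (norm (f y))\<^sup>2" .
qed simp

text \<open>This is the conjugate of \<open>m / 2 * (norm v)\<^sup>2\<close>: the infimum over
  \<open>v\<close> of the right-hand side in the hypothesis is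
  \<open>- ((norm f)\<^sup>2 / (2 * m))\<close>.\<close>

lemma minus_half_square_conjugate:
  fixes f :: "'a::real_normed_vector \<Rightarrow>\<^sub>L real"
  assumes m: "m > 0" and c: "\<And>v. c \<le> f v + m / 2 * (norm v)\<^sup>2"
  shows "c \<le> - ((norm f)\<^sup>2 / (2 * m))"
proof -
  have c0: "c \<le> 0" using c[of 0] by simp
  have sq: "(f v)\<^sup>2 \<le> (- 2 * m * c) * (norm v)\<^sup>2" for v
  proof (cases "v = 0")
    case False
    \<comment> \<open>The minimiser of the quadratic
      \<open>s * f v + m / 2 * s\<^sup>2 * (norm v)\<^sup>2\<close> in \<open>s\<close>.\<close>
    define s where "s = - f v / (m * (norm v)\<^sup>2)"
    have "c \<le> s * f v + m / 2 * (s\<^sup>2 * (norm v)\<^sup>2)"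
      using c[of "s *\<^sub>R v"] by (simp add: blinfun.scaleR_right power_mult_distrib)
    also have "\<dots> = - ((f v)\<^sup>2 / (2 * m * (norm v)\<^sup>2))"
      using m False unfolding s_def by (simp add: field_simps power2_eq_square)
    finally show ?thesis
      using m False by (simp add: field_simps)
  qed simp
  have "norm f \<le> sqrt (- 2 * m * c)"
  proof (rule norm_blinfun_bound)
    show "0 \<le> sqrt (- 2 * m * c)" using c0 m by (simp add: mult_nonneg_nonpos)
    fix v
    have "\<bar>f v\<bar> \<le> sqrt ((- 2 * m * c) * (norm v)\<^sup>2)"
      by (rule real_le_rsqrt) (use sq in simp)
    then show "norm (f v) \<le> sqrt (- 2 * m * c) * norm v"
      by (metis real_norm_def real_sqrt_abs real_sqrt_mult abs_norm_cancel)
  qed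
  then have "(norm f)\<^sup>2 \<le> (sqrt (- 2 * m * c))\<^sup>2"
    by (intro power_mono) auto
  also have "\<dots> = - 2 * m * c"
    using c0 m by (simp add: mult_nonneg_nonpos)
  finally show ?thesis using m by (simp add: field_simps)
qed

subsection \<open>The convexified graph\<close>

text \<open>The dual component comes first so that a bounded functional on
  \<open>'a dual \<times> 'a\<close> splits into a bidual element and a dual element, in the order
  of the pairs to which ultramaximality refers.\<close>

definition graph_hull :: "('a::real_normed_vector \<Rightarrow> 'a dual set) \<Rightarrow> (('a dual \<times> 'a) \<times> real) set"
  where "graph_hull A = convex hull ((\<lambda>(a, a'). ((a', a), blinfun_apply a' a)) ` gra A)"

lemma graph_hullI: "(a, a') \<in> gra A \<Longrightarrow> ((a', a), blinfun_apply a' a) \<in> graph_hull A"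
  unfolding graph_hull_def by (rule hull_inc) force

text \<open>Half-spaces are convex, so an affine inequality passes from the generators to the
  hull.\<close>

lemma graph_hull_halfspace:
  assumes f: "linear f" and gra: "\<And>a a'. (a, a') \<in> gra A \<Longrightarrow> 0 \<le> m + f ((a', a), blinfun_apply a' a)"
    and "z \<in> graph_hull A"
  shows "0 \<le> m + (f z :: real)"
proof -
  have "convex {z. - m \<le> f z}"
    using convex_linear_vimage[OF f convex_real_interval(1)[of "- m"]] by (simp add: vimage_def)
  moreover have "(\<lambda>(a, a'). ((a', a), blinfun_apply a' a)) ` gra A \<subseteq> {z. - m \<le> f z}"
    using gra by force
  ultimately have "graph_hull A \<subseteq> {z. - m \<le> f z}"
    unfolding graph_hull_def by (intro hull_minimal)
  with assms(3) show ?thesis by auto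
qed

text \<open>The form \<open>((a', a), t), ((b', b), s) \<mapsto> t - b' a - a' b + s\<close> is affine in each argument, so
  monotonicity extends to pairs of points of the hull; the claim is its diagonal case.\<close>

lemma graph_hull_ge_pairing:
  assumes A: "monotone_op A" and z: "((w', w), t) \<in> graph_hull A"
  shows "blinfun_apply w' w \<le> t"
proof -
  have lin: "linear (\<lambda>z :: ('a dual \<times> 'a) \<times> real. snd z - blinfun_apply b' (snd (fst z)) - blinfun_apply (fst (fst z)) b)"
    for b b'
    by (intro linearI) (auto simp: blinfun.bilinear_simps algebra_simps)
  have 1: "0 \<le> blinfun_apply b' b + (t - blinfun_apply b' w - blinfun_apply w' b)"
    if b: "(b, b') \<in> gra A" for b b'
  proof -
    have "0 \<le> blinfun_apply b' b + (blinfun_apply a' a - blinfun_apply b' a - blinfun_apply a' b)"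
      if "(a, a') \<in> gra A" for a a'
    proof -
      have "0 \<le> blinfun_apply (a' - b') (a - b)"
        using A b that unfolding monotone_op_def by blast
      then show ?thesis by (simp add: blinfun.bilinear_simps algebra_simps)
    qed
    then show ?thesis using graph_hull_halfspace[OF lin _ z, of "blinfun_apply b' b" b' b] by simp
  qed
  have "0 \<le> t + (blinfun_apply b' b - blinfun_apply w' b - blinfun_apply b' w)"
    if b: "(b, b') \<in> gra A" for b b'
    using 1[OF that] by simp
  from graph_hull_halfspace[OF lin _ z, of t w' w] this show ?thesis by simp
qed

text \<open>Expanding the pairing turns monotone relatedness to the graph into this form, which says
  that \<open>Fitzpatrick_bidual A\<close> at \<open>(x'', x')\<close> is at most the pairing of
  \<open>x''\<close> with \<open>x'\<close>.\<close>

lemma ultramaximally_monotoneD: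
  assumes "ultramaximally_monotone A"
    and "\<And>a a'. (a, a') \<in> gra A \<Longrightarrow>
      blinfun_apply x'' a' + blinfun_apply x' a - blinfun_apply a' a \<le> blinfun_apply x'' x'"
  shows "\<exists>x. x'' = bidual_embed x \<and> (x, x') \<in> gra A"
proof -
  have "0 \<le> blinfun_apply (x'' - bidual_embed a) (x' - a')" if "(a, a') \<in> gra A" for a a'
    using assms(2)[OF that] by (simp add: blinfun.bilinear_simps)
  then have "\<forall>(a, a') \<in> gra A. 0 \<le> blinfun_apply (x'' - bidual_embed a) (x' - a')" by blast
  then show ?thesis using assms(1) unfolding ultramaximally_monotone_def by blast
qed

text \<open>Every pair is vacuously related to an empty graph, and ultramaximality would then put a
  pair into it.\<close>

lemma gra_nonempty: "ultramaximally_monotone A \<Longrightarrow> gra A \<noteq> {}"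
  unfolding ultramaximally_monotone_def by blast

text \<open>The functional separating the hull from \<open>g\<close> is restricted to the two
  factors of the product: \<open>z''\<close> is its part on the dual, \<open>z'\<close> its part on
  the space.\<close>

lemma graph_sandwich:
  fixes A :: "'a::real_normed_vector \<Rightarrow> 'a dual set"
  assumes "gra A \<noteq> {}" and g: "convex_on UNIV g" "continuous_on UNIV g"
    and nonneg: "\<And>w w' t. ((w', w), t) \<in> graph_hull A \<Longrightarrow> 0 \<le> t + g (w', w)"
  obtains z'' :: "'a bidual" and z' :: "'a dual"
    where "\<And>a a' v v'. (a, a') \<in> gra A \<Longrightarrow>
      blinfun_apply z'' (a' - v') + blinfun_apply z' (a - v) \<le> blinfun_apply a' a + g (v', v)"
proof -
  have "convex (graph_hull A)" "graph_hull A \<noteq> {}"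
    using assms(1) by (auto simp: graph_hull_def)
  from convex_sandwich[OF this g] nonneg
  obtain f :: "('a dual \<times> 'a) \<Rightarrow>\<^sub>L real"
    where f: "\<And>w t v. (w, t) \<in> graph_hull A \<Longrightarrow> f (w - v) \<le> t + g v" by fast
  define z'' where "z'' = Blinfun (\<lambda>u'. f (u', 0))"
  define z' where "z' = Blinfun (\<lambda>u. f (0, u))"
  have "bounded_linear (\<lambda>u'. f (u', 0))"
    by (intro bounded_linear_intros bounded_linear_Pair)
  then have z'': "blinfun_apply z'' u' = f (u', 0)" for u'
    unfolding z''_def by (simp add: bounded_linear_Blinfun_apply)
  have "bounded_linear (\<lambda>u. f (0, u))"
    by (intro bounded_linear_intros bounded_linear_Pair)
  then have z': "blinfun_apply z' u = f (0, u)" for u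
    unfolding z'_def by (simp add: bounded_linear_Blinfun_apply)
  show thesis
  proof (rule that)
    fix a a' v v' assume "(a, a') \<in> gra A"
    from f[OF graph_hullI[OF this], of "(v', v)"]
    show "blinfun_apply z'' (a' - v') + blinfun_apply z' (a - v) \<le> blinfun_apply a' a + g (v', v)"
      by (simp add: z'' z' blinfun.add_right[symmetric])
  qed
qed

text \<open>For fixed \<open>x''\<close> and \<open>x'\<close> the hypothesis is affine in the
  points that generate the hull; the term with \<open>x''\<close> is then estimated by
  norms.\<close>

lemma bounded_on_graph_hull:
  assumes M: "\<And>a a'. (a, a') \<in> gra A \<Longrightarrow>
      blinfun_apply x'' a' + blinfun_apply x' a - blinfun_apply a' a \<le> M"
    and z: "((w', w), t) \<in> graph_hull A"
  shows "blinfun_apply x' w \<le> t + M + norm x'' * norm w'"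
proof -
  have lin: "linear (\<lambda>z :: ('a dual \<times> 'a) \<times> real. snd z - blinfun_apply x'' (fst (fst z)) - blinfun_apply x' (snd (fst z)))"
    by (intro linearI) (auto simp: blinfun.bilinear_simps algebra_simps)
  have "0 \<le> M + (t - blinfun_apply x'' w' - blinfun_apply x' w)"
    using graph_hull_halfspace[OF lin _ z, of M] M by (simp add: algebra_simps)
  moreover have "- blinfun_apply x'' w' \<le> norm x'' * norm w'"
    using norm_blinfun[of x'' w'] by simp
  ultimately show ?thesis by linarith
qed

subsection \<open>Domains of the Fitzpatrick functions\<close>

text \<open>On a nonempty graph the supremum exceeds \<open>- \<infinity>\<close>, so finiteness
  amounts to boundedness above.\<close>

lemma finite_dom_Fitzpatrick_bidual_iff:
  assumes "gra A \<noteq> {}"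
  shows "(x'', x') \<in> finite_dom (Fitzpatrick_bidual A) \<longleftrightarrow>
    (\<exists>M. \<forall>(a, a')\<in>gra A. blinfun_apply x'' a' + blinfun_apply x' a - blinfun_apply a' a \<le> M)"
    (is "_ \<longleftrightarrow> (\<exists>M. \<forall>(a, a')\<in>gra A. ?e a a' \<le> M)")
proof -
  obtain b b' where b: "(b, b') \<in> gra A" using assms by auto
  define F where "F = Fitzpatrick_bidual A (x'', x')"
  have F: "F = (SUP (a, a')\<in>gra A. ereal (?e a a'))"
    by (simp add: F_def Fitzpatrick_bidual_def)
  have up: "ereal (?e a a') \<le> F" if "(a, a') \<in> gra A" for a a'
    unfolding F using that by (intro SUP_upper2[of "(a, a')"]) auto
  have "F \<noteq> - \<infinity>" using up[OF b] by auto
  moreover have "F \<noteq> \<infinity> \<longleftrightarrow> (\<exists>M. \<forall>(a, a')\<in>gra A. ?e a a' \<le> M)"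
  proof
    assume "F \<noteq> \<infinity>"
    with \<open>F \<noteq> - \<infinity>\<close> obtain M where "F = ereal M" by (cases F) auto
    with up show "\<exists>M. \<forall>(a, a')\<in>gra A. ?e a a' \<le> M" by auto
  next
    assume "\<exists>M. \<forall>(a, a')\<in>gra A. ?e a a' \<le> M"
    then obtain M where "\<forall>(a, a')\<in>gra A. ?e a a' \<le> M" ..
    then have "F \<le> ereal M" unfolding F by (intro SUP_least) auto
    then show "F \<noteq> \<infinity>" by auto
  qed
  ultimately show ?thesis by (auto simp: finite_dom_def F_def)
qed

lemma Fitzpatrick_eq_bidual: "Fitzpatrick A (x, x') = Fitzpatrick_bidual A (bidual_embed x, x')"
  by (simp add: Fitzpatrick_def Fitzpatrick_bidual_def)

lemma finite_dom_Fitzpatrick_iff: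
  assumes "gra A \<noteq> {}"
  shows "(x, x') \<in> finite_dom (Fitzpatrick A) \<longleftrightarrow>
    (\<exists>M. \<forall>(a, a')\<in>gra A. blinfun_apply a' x + blinfun_apply x' a - blinfun_apply a' a \<le> M)"
  using finite_dom_Fitzpatrick_bidual_iff[OF assms, of "bidual_embed x" x']
  by (simp add: finite_dom_def Fitzpatrick_eq_bidual)

lemma snd_finite_dom_Fitzpatrick_subset:
  "snd ` finite_dom (Fitzpatrick A) \<subseteq> snd ` finite_dom (Fitzpatrick_bidual A)"
proof
  fix x' assume "x' \<in> snd ` finite_dom (Fitzpatrick A)"
  then obtain x where "(x, x') \<in> finite_dom (Fitzpatrick A)" by auto
  then have "(bidual_embed x, x') \<in> finite_dom (Fitzpatrick_bidual A)"
    by (simp add: finite_dom_def Fitzpatrick_eq_bidual)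
  then show "x' \<in> snd ` finite_dom (Fitzpatrick_bidual A)" by force
qed

lemma op_ran_subset_snd_finite_dom_Fitzpatrick:
  assumes "monotone_op A"
  shows "op_ran A \<subseteq> snd ` finite_dom (Fitzpatrick A)"
proof
  fix x' assume "x' \<in> op_ran A"
  then obtain x where x: "(x, x') \<in> gra A" by (auto simp: op_ran_def gra_def)
  \<comment> \<open>Monotonicity makes the pairing at the graph point itself an upper bound in the
    Fitzpatrick supremum.\<close>
  have "blinfun_apply a' x + blinfun_apply x' a - blinfun_apply a' a \<le> blinfun_apply x' x"
    if "(a, a') \<in> gra A" for a a'
  proof -
    have "0 \<le> blinfun_apply (a' - x') (a - x)"
      using assms x that unfolding monotone_op_def by blast
    then show ?thesis by (simp add: blinfun.bilinear_simps)
  qed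
  with x have "(x, x') \<in> finite_dom (Fitzpatrick A)"
    by (subst finite_dom_Fitzpatrick_iff) auto
  then show "x' \<in> snd ` finite_dom (Fitzpatrick A)" by force
qed

lemma convex_snd_finite_dom_Fitzpatrick:
  assumes "gra A \<noteq> {}"
  shows "convex (snd ` finite_dom (Fitzpatrick A))"
proof (rule convex_linear_image[OF linear_snd], rule convexI)
  fix p q and u v :: real
  assume p: "p \<in> finite_dom (Fitzpatrick A)" and q: "q \<in> finite_dom (Fitzpatrick A)"
    and uv: "0 \<le> u" "0 \<le> v" "u + v = 1"
  obtain x x' y y' where pq: "p = (x, x')" "q = (y, y')" by fastforce
  obtain M N where M: "\<And>a a'. (a, a') \<in> gra A \<Longrightarrow>
        blinfun_apply a' x + blinfun_apply x' a - blinfun_apply a' a \<le> M"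
    and N: "\<And>a a'. (a, a') \<in> gra A \<Longrightarrow>
        blinfun_apply a' y + blinfun_apply y' a - blinfun_apply a' a \<le> N"
    using p q unfolding pq finite_dom_Fitzpatrick_iff[OF assms] by blast
  have "blinfun_apply a' (u *\<^sub>R x + v *\<^sub>R y) + blinfun_apply (u *\<^sub>R x' + v *\<^sub>R y') a - blinfun_apply a' a
      \<le> u * M + v * N" if "(a, a') \<in> gra A" for a a'
  proof -
    have "blinfun_apply a' a = u * blinfun_apply a' a + v * blinfun_apply a' a"
      using uv(3) by (simp flip: distrib_right)
    then show ?thesis
      using mult_left_mono[OF M[OF that] uv(1)] mult_left_mono[OF N[OF that] uv(2)]
      by (simp add: blinfun.bilinear_simps algebra_simps)
  qed
  then show "u *\<^sub>R p + v *\<^sub>R q \<in> finite_dom (Fitzpatrick A)"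
    unfolding pq by (auto simp: finite_dom_Fitzpatrick_iff[OF assms])
qed

subsection \<open>The range of an ultramaximally monotone operator\<close>

text \<open>The bound uses the norm of the embedded point because that is the quantity controlled by
  uniform boundedness on the dual.\<close>

lemma bidual_embed_pairing_le: "\<bar>blinfun_apply w' w\<bar> \<le> norm (bidual_embed w) * norm w'"
  using norm_blinfun[of "bidual_embed w" w'] by simp

lemma zero_in_op_ran:
  fixes A :: "'a::real_normed_vector \<Rightarrow> 'a dual set"
  assumes A: "ultramaximally_monotone A"
    and int: "0 \<in> interior (snd ` finite_dom (Fitzpatrick_bidual A))"
  shows "0 \<in> op_ran A"
proof -
  let ?D = "snd ` finite_dom (Fitzpatrick_bidual A)"
  have mono: "monotone_op A" using A by (simp add: ultramaximally_monotone_def)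
  note ne = gra_nonempty[OF A]
  obtain r where r: "r > 0" "cball 0 r \<subseteq> ?D" using int by (auto simp: mem_interior_cball)
  have bound: "\<exists>n\<ge>0. \<forall>w w' t. ((w', w), t) \<in> graph_hull A \<longrightarrow>
      blinfun_apply u w \<le> t + n * (1 + norm w')" if u: "u \<in> ?D" for u
  proof -
    obtain x'' M where M: "\<forall>(a, a')\<in>gra A.
        blinfun_apply x'' a' + blinfun_apply u a - blinfun_apply a' a \<le> M"
      using u by (auto simp: finite_dom_Fitzpatrick_bidual_iff[OF ne])
    have "blinfun_apply u w \<le> t + max 0 (max M (norm x'')) * (1 + norm w')"
      if "((w', w), t) \<in> graph_hull A" for w w' t
    proof -
      have "blinfun_apply u w \<le> t + M + norm x'' * norm w'"
        using bounded_on_graph_hull[OF _ that] M by blast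
      also have "\<dots> \<le> t + max 0 (max M (norm x'')) + max 0 (max M (norm x'')) * norm w'"
        by (intro add_mono mult_right_mono) auto
      finally show ?thesis by (simp add: algebra_simps)
    qed
    then show ?thesis by (intro exI[of _ "max 0 (max M (norm x''))"]) auto
  qed
  have "0 \<in> ?D" using r by auto
  from bound[OF this] obtain n where n: "n \<ge> 0"
    and n_le: "\<And>w w' t. ((w', w), t) \<in> graph_hull A \<Longrightarrow> 0 \<le> t + n * (1 + norm w')"
    by auto
  \<comment> \<open>Taking \<open>n + 1\<close> instead of \<open>n\<close> leaves a margin of
    \<open>1 + norm w'\<close>, so division by \<open>T w' t\<close> is possible and the error term
    \<open>1 + norm w'\<close> is absorbed.\<close>
  define T where "T w' t = t + (n + 1) * (1 + norm w')" for w' :: "'a dual" and t :: real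
  have T: "T w' t \<ge> 1 + norm w'" if "((w', w), t) \<in> graph_hull A" for w w' t
    using n_le[OF that] by (simp add: T_def algebra_simps)
  have T0: "T w' t > 0" if "((w', w), t) \<in> graph_hull A" for w w' t
    using T[OF that] norm_ge_zero[of w'] by linarith
  \<comment> \<open>\<open>T w' t > 0\<close> uses only \<open>0 \<in> ?D\<close>; the ball around \<open>0\<close> makes \<open>F\<close> pointwise bounded\<close>
  define F where "F = {(1 / T w' t) *\<^sub>R bidual_embed w | w w' t. ((w', w), t) \<in> graph_hull A}"
  have "\<exists>k\<ge>0. \<forall>f\<in>F. norm f \<le> k"
  proof (rule uniform_boundedness)
    fix u :: "'a dual"
    \<comment> \<open>The multiple \<open>e *\<^sub>R u\<close> lies in the ball of radius
      \<open>r\<close>, hence in \<open>?D\<close>, and its bound is rescaled. Applying this to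
      \<open>u\<close> and \<open>- u\<close> gives a two-sided estimate.\<close>
    have half: "\<exists>k. \<forall>w w' t. ((w', w), t) \<in> graph_hull A \<longrightarrow> blinfun_apply u w / T w' t \<le> k"
      for u :: "'a dual"
    proof -
      define e where "e = r / (norm u + 1)"
      have e: "e > 0" using r by (simp add: e_def add_nonneg_pos)
      have "norm (e *\<^sub>R u) \<le> r"
        using r by (simp add: e_def divide_le_eq add_nonneg_pos)
      then have "e *\<^sub>R u \<in> ?D" using r by auto
      from bound[OF this] obtain m where m: "m \<ge> 0"
        and le: "\<And>w w' t. ((w', w), t) \<in> graph_hull A \<Longrightarrow>
            e * blinfun_apply u w \<le> t + m * (1 + norm w')"
        by (auto simp: blinfun.scaleR_left)
      have "blinfun_apply u w / T w' t \<le> (1 + m) / e" if h: "((w', w), t) \<in> graph_hull A" for w w' t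
      proof -
        have "t \<le> T w' t" using n by (simp add: T_def)
        then have "e * blinfun_apply u w \<le> T w' t + m * T w' t"
          using le[OF h] mult_left_mono[OF T[OF h] m] by linarith
        then show ?thesis using e T0[OF h] by (simp add: field_simps)
      qed
      then show ?thesis by blast
    qed
    obtain k where k: "\<And>w w' t. ((w', w), t) \<in> graph_hull A \<Longrightarrow> blinfun_apply u w / T w' t \<le> k"
      using half by blast
    obtain l where l: "\<And>w w' t. ((w', w), t) \<in> graph_hull A \<Longrightarrow> - blinfun_apply u w / T w' t \<le> l"
      using half[of "- u"] by (auto simp: blinfun.minus_left)
    have "norm (blinfun_apply f u) \<le> max k l" if f: "f \<in> F" for f
    proof -
      obtain w w' t where h: "((w', w), t) \<in> graph_hull A"
        and f_eq: "f = (1 / T w' t) *\<^sub>R bidual_embed w"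
        using f by (auto simp: F_def)
      from k[OF h] l[OF h] show ?thesis by (auto simp: f_eq blinfun.scaleR_left abs_le_iff)
    qed
    then show "\<exists>k. \<forall>f\<in>F. norm (blinfun_apply f u) \<le> k" by blast
  qed
  then obtain k where k: "k \<ge> 0" "\<And>f. f \<in> F \<Longrightarrow> norm f \<le> k" by blast
  \<comment> \<open>The increment makes the constant strictly positive, so it can later be
    cancelled.\<close>
  define k1 where "k1 = k + 1"
  have k1: "norm (bidual_embed w) \<le> k1 * (t + (n + 1) * (1 + norm w'))"
    if h: "((w', w), t) \<in> graph_hull A" for w w' t
  proof -
    have "(1 / T w' t) *\<^sub>R bidual_embed w \<in> F" using h by (auto simp: F_def)
    from k(2)[OF this] have "norm (bidual_embed w) \<le> k * T w' t"
      using T0[OF h] by (simp add: field_simps)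
    also have "\<dots> \<le> k1 * T w' t" using T0[OF h] by (simp add: k1_def)
    finally show ?thesis by (simp add: T_def)
  qed
  have "k1 > 0" using k by (simp add: k1_def)
  define N where "N = n + 1"
  have "N > 0" using n by (simp add: N_def)
  \<comment> \<open>Two regimes occur when \<open>t < 0\<close>. If \<open>norm w' \<le> 1\<close>,
    the embedded \<open>w\<close> has norm at most \<open>2 * (k1 * N)\<close> and \<open>t\<close>
    dominates the pairing; otherwise \<open>t + N * (1 + norm w') \<ge> 0\<close> and
    \<open>1 + norm w' \<le> 2 * norm w'\<close>.\<close>
  define K where "K = max (2 * (k1 * N)) (2 * N)"
  define g where "g = (\<lambda>(v' :: 'a dual, v :: 'a). K * norm v')"
  have "0 \<le> t + g (w', w)" if h: "((w', w), t) \<in> graph_hull A" for w w' t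
  proof (cases "t \<ge> 0")
    case True
    then show ?thesis using \<open>N > 0\<close> by (simp add: K_def g_def)
  next
    case False
    have K: "x * norm w' \<le> K * norm w'" if "x \<le> K" for x
      using that by (intro mult_right_mono) auto
    show ?thesis
    proof (cases "norm w' \<le> 1")
      case True
      have "norm (bidual_embed w) \<le> k1 * (t + N * (1 + norm w'))"
        using k1[OF h] by (simp add: N_def)
      also have "\<dots> \<le> k1 * (N * 2)"
      proof (rule mult_left_mono)
        have "N * (1 + norm w') \<le> N * 2"
          using True \<open>N > 0\<close> by (intro mult_left_mono) auto
        then show "t + N * (1 + norm w') \<le> N * 2" using False by simp
      qed (use \<open>k1 > 0\<close> in simp)
      finally have "norm (bidual_embed w) * norm w' \<le> K * norm w'"
        by (intro K) (simp add: K_def)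
      then show ?thesis
        using graph_hull_ge_pairing[OF mono h] bidual_embed_pairing_le[of w' w]
        by (simp add: g_def abs_le_iff)
    next
      case s: False
      have "0 \<le> k1 * (t + N * (1 + norm w'))"
        using k1[OF h] norm_ge_zero[of "bidual_embed w"] unfolding N_def by linarith
      then have "0 \<le> t + N * (1 + norm w')"
        using \<open>k1 > 0\<close> by (simp add: zero_le_mult_iff)
      moreover have "N * (1 + norm w') \<le> N * (2 * norm w')"
        using s \<open>N > 0\<close> by (intro mult_left_mono) auto
      moreover have "2 * N * norm w' \<le> K * norm w'" by (rule K) (simp add: K_def)
      ultimately show ?thesis by (simp add: g_def)
    qed
  qed
  moreover have "convex_on UNIV g"
  proof -
    have "K \<ge> 0" using \<open>N > 0\<close> by (simp add: K_def)
    moreover have "convex_on UNIV (\<lambda>p :: 'a dual \<times> 'a. norm (fst p))"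
      by (rule convex_on_norm_linear) (rule linear_fst)
    ultimately show ?thesis unfolding g_def case_prod_beta by (rule convex_on_cmul)
  qed
  moreover have "continuous_on UNIV g"
    unfolding g_def case_prod_beta by (intro continuous_intros)
  ultimately obtain z'' :: "'a bidual" and z' :: "'a dual"
    where z: "\<And>a a' v v'. (a, a') \<in> gra A \<Longrightarrow>
      blinfun_apply z'' (a' - v') + blinfun_apply z' (a - v) \<le> blinfun_apply a' a + g (v', v)"
    using graph_sandwich[OF ne, of g] by blast
  \<comment> \<open>With \<open>v' = 0\<close> and \<open>v = a\<close> both \<open>g\<close> and
    the term with \<open>z'\<close> vanish; what remains is relatedness of \<open>(z'', 0)\<close>
    to the graph.\<close>
  have "blinfun_apply z'' a' \<le> blinfun_apply a' a" if "(a, a') \<in> gra A" for a a'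
    using z[OF that, of 0 a] by (simp add: g_def)
  then have "\<exists>x. z'' = bidual_embed x \<and> (x, 0) \<in> gra A"
    by (intro ultramaximally_monotoneD[OF A]) simp
  then show ?thesis by (auto simp: op_ran_def gra_def)
qed

lemma zero_in_closure_op_ran:
  fixes A :: "'a::real_normed_vector \<Rightarrow> 'a dual set"
  assumes A: "ultramaximally_monotone A"
    and dom: "0 \<in> snd ` finite_dom (Fitzpatrick_bidual A)"
  shows "0 \<in> closure (op_ran A)"
proof -
  have mono: "monotone_op A" using A by (simp add: ultramaximally_monotone_def)
  note ne = gra_nonempty[OF A]
  obtain x'' M where M: "\<And>a a'. (a, a') \<in> gra A \<Longrightarrow>
      blinfun_apply x'' a' - blinfun_apply a' a \<le> M"
    using dom by (fastforce simp: finite_dom_Fitzpatrick_bidual_iff[OF ne])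
  have ex: "\<exists>z' \<in> op_ran A. (norm z')\<^sup>2 / (2 * m) \<le> M + norm x'' * norm z'" if m: "m > 0" for m
  proof -
    \<comment> \<open>By Young's inequality \<open>g (w', w)\<close> is at least
      \<open>norm w' * norm w\<close>, and the pairing below \<open>t\<close> is at least minus that
      product.\<close>
    define g where "g = (\<lambda>(v' :: 'a dual, v :: 'a). 1 / (2 * m) * (norm v')\<^sup>2 + m / 2 * (norm v)\<^sup>2)"
    have "convex_on UNIV g"
      unfolding g_def case_prod_beta using m
      by (intro convex_on_add convex_on_cmul convex_on_norm_linear_square linear_fst linear_snd) auto
    moreover have "continuous_on UNIV g"
      unfolding g_def case_prod_beta by (intro continuous_intros)
    moreover have "0 \<le> t + g (w', w)" if h: "((w', w), t) \<in> graph_hull A" for w w' t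
    proof -
      have "- (norm w' * norm w) \<le> t"
        using graph_hull_ge_pairing[OF mono h] norm_blinfun[of w' w] by (simp add: abs_le_iff)
      moreover have "g (w', w) - norm w' * norm w = (norm w' - m * norm w)\<^sup>2 / (2 * m)"
        using m by (simp add: g_def field_simps power2_eq_square)
      moreover have "0 \<le> (norm w' - m * norm w)\<^sup>2 / (2 * m)" using m by simp
      ultimately show ?thesis by linarith
    qed
    ultimately obtain z'' :: "'a bidual" and z' :: "'a dual"
      where z: "\<And>a a' v v'. (a, a') \<in> gra A \<Longrightarrow>
        blinfun_apply z'' (a' - v') + blinfun_apply z' (a - v) \<le> blinfun_apply a' a + g (v', v)"
      using graph_sandwich[OF ne, of g] by blast
    \<comment> \<open>The free \<open>v\<close> is eliminated by minimising over it. Below,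
      \<open>v' = z'\<close> makes the right-hand side vanish and allows ultramaximality, while
      \<open>v' = 0\<close> at the resulting graph point gives the quantitative estimate.\<close>
    have le: "blinfun_apply z'' (a' - v') + blinfun_apply z' a - blinfun_apply a' a
        \<le> (norm v')\<^sup>2 / (2 * m) - (norm z')\<^sup>2 / (2 * m)" if a: "(a, a') \<in> gra A" for a a' v'
    proof -
      have "blinfun_apply z'' (a' - v') + blinfun_apply z' a - blinfun_apply a' a - (norm v')\<^sup>2 / (2 * m)
          \<le> - ((norm z')\<^sup>2 / (2 * m))"
      proof (rule minus_half_square_conjugate[OF m])
        fix v
        show "blinfun_apply z'' (a' - v') + blinfun_apply z' a - blinfun_apply a' a - (norm v')\<^sup>2 / (2 * m)
            \<le> blinfun_apply z' v + m / 2 * (norm v)\<^sup>2"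
          using z[OF a, of v' v] by (simp add: g_def blinfun.diff_right)
      qed
      then show ?thesis by simp
    qed
    have "blinfun_apply z'' a' + blinfun_apply z' a - blinfun_apply a' a \<le> blinfun_apply z'' z'"
      if "(a, a') \<in> gra A" for a a'
      using le[OF that, of z'] by (simp add: blinfun.diff_right)
    from ultramaximally_monotoneD[OF A this]
    obtain z where z: "z'' = bidual_embed z" "(z, z') \<in> gra A" by blast
    have "(norm z')\<^sup>2 / (2 * m) \<le> - blinfun_apply z' z"
      using le[OF z(2), of 0] by (simp add: z(1))
    also have "\<dots> \<le> M + norm x'' * norm z'"
      using M[OF z(2)] norm_blinfun[of x'' z'] by (simp add: abs_le_iff)
    finally show ?thesis using z(2) by (auto simp: op_ran_def gra_def)
  qed
  show ?thesis
    unfolding closure_approachable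
  proof (intro allI impI)
    fix e :: real assume e: "e > 0"
    \<comment> \<open>If \<open>norm z' \<ge> e\<close>, then
      \<open>M + norm x'' * norm z' < c * norm z'\<close>, the summand \<open>1\<close> giving
      strictness; with \<open>m = e / (2 * c)\<close> the left-hand side of the estimate is at least
      \<open>c * norm z'\<close>.\<close>
    define c where "c = 1 + \<bar>M\<bar> / e + norm x''"
    have c: "c > 0" using e by (simp add: c_def add_pos_nonneg)
    obtain z' where z': "z' \<in> op_ran A"
      and le: "(norm z')\<^sup>2 / (2 * (e / (2 * c))) \<le> M + norm x'' * norm z'"
      using ex[of "e / (2 * c)"] e c by auto
    have "norm z' < e"
    proof (rule ccontr)
      assume "\<not> norm z' < e"
      then have ge: "e \<le> norm z'" by simp
      then have pos: "norm z' > 0" using e by linarith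
      have "M \<le> \<bar>M\<bar> / e * e" using e by simp
      also have "\<dots> \<le> \<bar>M\<bar> / e * norm z'" using ge e by (intro mult_left_mono) auto
      finally have "M < (1 + \<bar>M\<bar> / e) * norm z'"
        unfolding distrib_right using pos by linarith
      then have "M + norm x'' * norm z' < c * norm z'"
        using pos by (simp add: c_def algebra_simps)
      also have "\<dots> \<le> c * norm z' * (norm z' / e)"
        using ge e c pos by (simp add: field_simps)
      also have "\<dots> = (norm z')\<^sup>2 / (2 * (e / (2 * c)))"
        using e c by (simp add: field_simps power2_eq_square)
      finally show False using le by simp
    qed
    with z' show "\<exists>y\<in>op_ran A. dist y 0 < e" by auto
  qed
qed

section \<open>Reduction to the origin by translating the range\<close>

definition shift_ran :: "'a dual \<Rightarrow> ('a::real_normed_vector \<Rightarrow> 'a dual set) \<Rightarrow> 'a \<Rightarrow> 'a dual set"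
  where "shift_ran c A x = (\<lambda>x'. x' - c) ` A x"

lemma gra_shift_ran: "gra (shift_ran c A) = (\<lambda>(x, x'). (x, x' - c)) ` gra A"
  by (force simp: gra_def shift_ran_def)

lemma op_ran_shift_ran: "op_ran (shift_ran c A) = (\<lambda>x'. x' - c) ` op_ran A"
  by (auto simp: op_ran_def shift_ran_def)

text \<open>Differences of dual points are unchanged, so \<open>(x'', x')\<close> is related to the
  shifted graph exactly when \<open>(x'', x' + c)\<close> is related to the original one.\<close>

lemma ultramaximally_monotone_shift_ran:
  assumes "ultramaximally_monotone A"
  shows "ultramaximally_monotone (shift_ran c A)"
  unfolding ultramaximally_monotone_def
proof (intro conjI allI impI)
  show "monotone_op (shift_ran c A)"
    using assms by (fastforce simp: ultramaximally_monotone_def monotone_op_def gra_shift_ran)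
  fix x'' x'
  assume "\<forall>(a, a')\<in>gra (shift_ran c A). 0 \<le> blinfun_apply (x'' - bidual_embed a) (x' - a')"
  then have "\<forall>(a, a')\<in>gra A. 0 \<le> blinfun_apply (x'' - bidual_embed a) ((x' + c) - a')"
    by (force simp: gra_shift_ran algebra_simps)
  then obtain x where "x'' = bidual_embed x" "(x, x' + c) \<in> gra A"
    using assms unfolding ultramaximally_monotone_def by blast
  then show "\<exists>x. x'' = bidual_embed x \<and> (x, x') \<in> gra (shift_ran c A)"
    by (force simp: gra_shift_ran)
qed

text \<open>Replacing \<open>a'\<close> by \<open>a' - c\<close> moves \<open>c\<close> onto
  \<open>x'\<close> and changes every term of the supremum by the same constant
  \<open>blinfun_apply x'' c\<close>, which does not affect boundedness.\<close>

lemma snd_finite_dom_Fitzpatrick_bidual_shift_ran: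
  assumes "gra A \<noteq> {}"
  shows "snd ` finite_dom (Fitzpatrick_bidual (shift_ran c A)) =
    (\<lambda>x'. x' - c) ` snd ` finite_dom (Fitzpatrick_bidual A)"
proof -
  have ne: "gra (shift_ran c A) \<noteq> {}" using assms by (simp add: gra_shift_ran)
  have iff: "(x'', x') \<in> finite_dom (Fitzpatrick_bidual (shift_ran c A)) \<longleftrightarrow>
      (x'', x' + c) \<in> finite_dom (Fitzpatrick_bidual A)" for x'' x'
  proof -
    have "(x'', x') \<in> finite_dom (Fitzpatrick_bidual (shift_ran c A)) \<longleftrightarrow>
      (\<exists>M. \<forall>(a, a')\<in>gra A. blinfun_apply x'' (a' - c) + blinfun_apply x' a - blinfun_apply (a' - c) a \<le> M)"
      by (simp add: finite_dom_Fitzpatrick_bidual_iff[OF ne] gra_shift_ran case_prod_beta)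
    also have "\<dots> \<longleftrightarrow> (\<exists>M. \<forall>(a, a')\<in>gra A.
        blinfun_apply x'' a' + blinfun_apply (x' + c) a - blinfun_apply a' a \<le> M + blinfun_apply x'' c)"
      by (intro arg_cong[where f = Ex] ext ball_cong refl)
        (simp add: case_prod_beta blinfun.bilinear_simps algebra_simps)
    also have "\<dots> \<longleftrightarrow> (\<exists>M. \<forall>(a, a')\<in>gra A.
        blinfun_apply x'' a' + blinfun_apply (x' + c) a - blinfun_apply a' a \<le> M)"
    proof (intro iffI; elim exE)
      fix M assume "\<forall>(a, a')\<in>gra A. blinfun_apply x'' a' + blinfun_apply (x' + c) a - blinfun_apply a' a \<le> M"
      then show "\<exists>M. \<forall>(a, a')\<in>gra A. blinfun_apply x'' a' + blinfun_apply (x' + c) a - blinfun_apply a' a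
          \<le> M + blinfun_apply x'' c"
        by (intro exI[of _ "M - blinfun_apply x'' c"]) simp
    qed blast
    finally show ?thesis by (simp add: finite_dom_Fitzpatrick_bidual_iff[OF assms])
  qed
  show ?thesis
  proof (intro equalityI subsetI)
    fix x' assume "x' \<in> snd ` finite_dom (Fitzpatrick_bidual (shift_ran c A))"
    then obtain x'' where "(x'', x' + c) \<in> finite_dom (Fitzpatrick_bidual A)"
      using iff by auto
    then have "x' + c \<in> snd ` finite_dom (Fitzpatrick_bidual A)" by force
    then show "x' \<in> (\<lambda>x'. x' - c) ` snd ` finite_dom (Fitzpatrick_bidual A)"
      by (rule rev_image_eqI) simp
  next
    fix x' assume "x' \<in> (\<lambda>x'. x' - c) ` snd ` finite_dom (Fitzpatrick_bidual A)"
    then obtain x'' where "(x'', x' + c) \<in> finite_dom (Fitzpatrick_bidual A)" by auto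
    then have "(x'', x') \<in> finite_dom (Fitzpatrick_bidual (shift_ran c A))" using iff by blast
    then show "x' \<in> snd ` finite_dom (Fitzpatrick_bidual (shift_ran c A))" by force
  qed
qed

lemma interior_subset_op_ran:
  assumes A: "ultramaximally_monotone A"
  shows "interior (snd ` finite_dom (Fitzpatrick_bidual A)) \<subseteq> op_ran A"
proof
  fix c assume c: "c \<in> interior (snd ` finite_dom (Fitzpatrick_bidual A))"
  have "0 \<in> op_ran (shift_ran c A)"
  proof (rule zero_in_op_ran[OF ultramaximally_monotone_shift_ran[OF A]])
    have "0 \<in> (\<lambda>x'. x' - c) ` interior (snd ` finite_dom (Fitzpatrick_bidual A))"
      using c by (rule rev_image_eqI) simp
    then show "0 \<in> interior (snd ` finite_dom (Fitzpatrick_bidual (shift_ran c A)))"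
      by (simp add: snd_finite_dom_Fitzpatrick_bidual_shift_ran[OF gra_nonempty[OF A]]
          interior_translation_subtract)
  qed
  then show "c \<in> op_ran A" by (auto simp: op_ran_shift_ran)
qed

lemma subset_closure_op_ran:
  assumes A: "ultramaximally_monotone A"
  shows "snd ` finite_dom (Fitzpatrick_bidual A) \<subseteq> closure (op_ran A)"
proof
  fix c assume c: "c \<in> snd ` finite_dom (Fitzpatrick_bidual A)"
  have "0 \<in> closure (op_ran (shift_ran c A))"
  proof (rule zero_in_closure_op_ran[OF ultramaximally_monotone_shift_ran[OF A]])
    have "0 \<in> (\<lambda>x'. x' - c) ` snd ` finite_dom (Fitzpatrick_bidual A)"
      using c by (rule rev_image_eqI) simp
    then show "0 \<in> snd ` finite_dom (Fitzpatrick_bidual (shift_ran c A))"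
      by (simp only: snd_finite_dom_Fitzpatrick_bidual_shift_ran[OF gra_nonempty[OF A]])
  qed
  then show "c \<in> closure (op_ran A)"
    by (auto simp: op_ran_shift_ran closure_translation_subtract)
qed

theorem theorem3p4:
  fixes A :: "'a::banach \<Rightarrow> 'a dual set"
  assumes "ultramaximally_monotone A"
  shows "interior (op_ran A) = interior (convex hull (op_ran A)) \<and>
         interior (convex hull (op_ran A)) = interior (snd ` finite_dom (Fitzpatrick A)) \<and>
         interior (snd ` finite_dom (Fitzpatrick A)) =
           interior (snd ` finite_dom (Fitzpatrick_bidual A)) \<and>
         closure (op_ran A) = closure (convex hull (op_ran A)) \<and>
         closure (convex hull (op_ran A)) = closure (snd ` finite_dom (Fitzpatrick A)) \<and>
         closure (snd ` finite_dom (Fitzpatrick A)) =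
           closure (snd ` finite_dom (Fitzpatrick_bidual A))"
proof -
  let ?R = "op_ran A" and ?F = "snd ` finite_dom (Fitzpatrick A)"
    and ?P = "snd ` finite_dom (Fitzpatrick_bidual A)"
  have mono: "monotone_op A" using assms by (simp add: ultramaximally_monotone_def)
  have sub: "?R \<subseteq> convex hull ?R" "convex hull ?R \<subseteq> ?F" "?F \<subseteq> ?P"
  proof -
    show "?R \<subseteq> convex hull ?R" by (rule hull_subset)
    show "convex hull ?R \<subseteq> ?F"
      by (intro hull_minimal op_ran_subset_snd_finite_dom_Fitzpatrick[OF mono]
          convex_snd_finite_dom_Fitzpatrick[OF gra_nonempty[OF assms]])
    show "?F \<subseteq> ?P" by (rule snd_finite_dom_Fitzpatrick_subset)
  qed
  \<comment> \<open>The interior of the largest set is open and contained in the smallest, which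
    closes the chain of interiors; closures are handled dually.\<close>
  have "interior ?P \<subseteq> interior ?R"
    using interior_subset_op_ran[OF assms] by (intro interior_maximal) auto
  moreover have "closure ?P \<subseteq> closure ?R"
    using subset_closure_op_ran[OF assms] by (intro closure_minimal) auto
  ultimately show ?thesis
    using sub[THEN interior_mono] sub[THEN closure_mono] by blast
qed

end
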